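(* Let $X = X(\omega_1)$ be the inverse limit constructed in the context. The trivial composant $E$ of $X$ is non-separable.
   Context: A continuum is a nondegenerate compact connected Hausdorff space; a subcontinuum is a subspace that is itself a continuum. The composant $\kappa(x)$ of a point $x$ of a continuum is the union of all proper subcontinua containing $x$. For points $a,b$ of a continuum, $[a,b]$ denotes the intersection of all subcontinua containing $\{a,b\}$. $\mathbb N = \{1,2,\ldots\}$. Construction of $X$. By transfinite recursion one defines, for each $\alpha \le \omega_1$, a continuum $X(\alpha)$, a point $a_\alpha \in X(\alpha)$, a sequence of points $(q^n_\alpha)_{n \in \mathbb N}$ in $X(\alpha)$, and, for each $\beta \le \alpha$, a continuous map $f^\alpha_\beta : X(\alpha) \to X(\beta)$ (with $f^\alpha_\alpha = \mathrm{id}$) together with an embedding of $X(\beta)$ as a subspace of $X(\alpha)$ for which $f^\alpha_\beta$ is a retraction. Stage $0$: $X(0)$ is the $\sin(1/x)$ continuum $\{(x,\sin(1/x)) : -2/\pi \le x < 0\} \cup (\{0\}\times[-1,1])$, $a_0 = (-2/\pi,-1)$, and $(q^n_0)$ is a chosen sequence of points of the graph $\{(x,\sin(1/x)) : -2/\pi < x < 0\}$ whose $x$-coordinates strictly increase to $0$. Successor stage: let $N = \bigcup_{n \in \mathbb N} \big([a_\beta,q^n_\beta] \times \{1/(2n-1), 1/(2n)\}\big) \cup (X(\beta)\times\{0\}) \subset X(\beta)\times[0,1]$. The space $X(\beta+1)$ is the quotient of $N$ obtained by making, for each $n \in \mathbb N$, the identifications $(q^n_\beta, 1/(2n-1)) \sim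 (q^n_\beta,1/(2n))$ and $(a_\beta,1/(2n)) \sim (a_\beta, 1/(2n+1))$. $X(\beta)$ is identified with the subspace $X(\beta)\times\{0\}$; $f^{\beta+1}_\beta$ is induced by the projection $X(\beta)\times[0,1]\to X(\beta)$; $f^{\beta+1}_\gamma = f^\beta_\gamma \circ f^{\beta+1}_\beta$ for $\gamma \le \beta$; $a_{\beta+1}$ is the class of $(a_\beta,1)$; and $q^n_{\beta+1}$ is the class of $(q^n_\beta,1/(2n-1))$. Limit stage ($\alpha \le \omega_1$ a limit ordinal): $X(\alpha) = \varprojlim\{X(\beta); f^\beta_\gamma : \gamma \le \beta < \alpha\}$, the maps $f^\alpha_\beta$ are the projections, $a_\alpha = (a_\beta)_{\beta<\alpha}$, $q^n_\alpha = (q^n_\beta)_{\beta<\alpha}$, and for $\gamma<\alpha$ the space $X(\gamma)$ is identified with the subspace $\{x \in X(\alpha) : x_\beta = x_\gamma \text{ for all } \gamma \le \beta < \alpha\}$ (using $X(\gamma)\subset X(\beta)$). $X = X(\omega_1)$ is an indecomposable continuum with exactly two composants: the trivial composant $E = \bigcup\{X(\alpha) : \alpha<\omega_1\}$ and the nontrivial composant $X - E = \varprojlim\{\kappa(a_\alpha); f^\alpha_\beta : \beta \le \alpha<\omega_1\}$. *)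

theory Defs
  imports "HOL-Analysis.Analysis" "HOL-Library.FSet"
begin

section \<open>Continua\<close>

definition continuum :: "'a topology \<Rightarrow> bool" where
  "continuum T \<longleftrightarrow> compact_space T \<and> connected_space T \<and> Hausdorff_space T \<and>
     (\<exists>x\<in>topspace T. \<exists>y\<in>topspace T. x \<noteq> y)"

definition subcontinuum :: "'a topology \<Rightarrow> 'a set \<Rightarrow> bool" where
  "subcontinuum T C \<longleftrightarrow> C \<subseteq> topspace T \<and> continuum (subtopology T C)"

definition cinterval :: "'a topology \<Rightarrow> 'a \<Rightarrow> 'a \<Rightarrow> 'a set" where
  "cinterval T a b = \<Inter>{C. subcontinuum T C \<and> {a, b} \<subseteq> C}"

section \<open>Quotient topology along a map\<close>

definition quot_topology :: "'a topology \<Rightarrow> ('a \<Rightarrow> 'b) \<Rightarrow> 'b topology" where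
  "quot_topology T p =
     topology (\<lambda>U. U \<subseteq> p ` topspace T \<and> openin T {x \<in> topspace T. p x \<in> U})"

lemma openin_quot_topology:
  "openin (quot_topology T p) U \<longleftrightarrow>
     U \<subseteq> p ` topspace T \<and> openin T {x \<in> topspace T. p x \<in> U}"
proof -
  have "istopology (\<lambda>U. U \<subseteq> p ` topspace T \<and> openin T {x \<in> topspace T. p x \<in> U})"
    unfolding istopology_def
  proof (intro conjI allI impI)
    fix S U
    assume S: "S \<subseteq> p ` topspace T \<and> openin T {x \<in> topspace T. p x \<in> S}"
      and U: "U \<subseteq> p ` topspace T \<and> openin T {x \<in> topspace T. p x \<in> U}"
    have "{x \<in> topspace T. p x \<in> S \<inter> U} =
        {x \<in> topspace T. p x \<in> S} \<inter> {x \<in> topspace T. p x \<in> U}"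
      by auto
    then show "openin T {x \<in> topspace T. p x \<in> S \<inter> U}"
      using S U by auto
    show "S \<inter> U \<subseteq> p ` topspace T"
      using S by auto
  next
    fix K
    assume K: "\<forall>U\<in>K. U \<subseteq> p ` topspace T \<and> openin T {x \<in> topspace T. p x \<in> U}"
    have "{x \<in> topspace T. p x \<in> \<Union>K} = (\<Union>U\<in>K. {x \<in> topspace T. p x \<in> U})"
      by auto
    then show "openin T {x \<in> topspace T. p x \<in> \<Union>K}"
      using K by (auto intro!: openin_Union)
    show "\<Union>K \<subseteq> p ` topspace T"
      using K by auto
  qed
  then show ?thesis
    unfolding quot_topology_def by (simp add: topology_inverse')
qed

lemma topspace_quot_topology: "topspace (quot_topology T p) = p ` topspace T"
proof (rule antisym)
  show "topspace (quot_topology T p) \<subseteq> p ` topspace T"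
    using openin_topspace[of "quot_topology T p"] unfolding openin_quot_topology by (rule conjunct1)
  have "{x \<in> topspace T. p x \<in> p ` topspace T} = topspace T"
    by auto
  then have "openin (quot_topology T p) (p ` topspace T)"
    by (simp add: openin_quot_topology)
  then show "p ` topspace T \<subseteq> topspace (quot_topology T p)"
    by (rule openin_subset)
qed

lemma quotient_map_quot_topology: "quotient_map T (quot_topology T p) p"
  unfolding quotient_map_def
  by (auto simp: topspace_quot_topology openin_quot_topology)

section \<open>The stages\<close>

text \<open>
  One type holds the points of all stages: points of the plane, equivalence classes of pairs
  in \<open>X(\<beta>) \<times> [0,1]\<close> (these classes have at most two elements), and threads, that is points of
  an inverse limit, which are functions that are undefined outside \<open>{..<\<alpha>}\<close>. For an
  injective constructor, the topology \<open>quot_topology\<close> along it is the homeomorphic copy.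
\<close>

datatype 'i pt =
    Base "real \<times> real"
  | Cls "('i pt \<times> real) fset"
  | Thread "'i \<Rightarrow> 'i pt"

primrec un_Thread :: "'i pt \<Rightarrow> 'i \<Rightarrow> 'i pt" where
  "un_Thread (Thread x) = x"

text \<open>
  The data of stage \<open>\<alpha>\<close>: \<open>ret \<beta>\<close> is the retraction \<open>X(\<alpha>) \<rightarrow> X(\<beta>)\<close> and \<open>emb \<beta>\<close> the embedding
  \<open>X(\<beta>) \<rightarrow> X(\<alpha>)\<close>, both meaningful for \<open>\<beta> \<le> \<alpha>\<close> only
  (and the identity for \<open>\<beta> = \<alpha>\<close>). Only the points \<open>ptq n\<close> with \<open>n \<ge> 1\<close>
  matter.
\<close>

record 'i stage =
  spc :: "'i pt topology"
  pta :: "'i pt"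
  ptq :: "nat \<Rightarrow> 'i pt"
  ret :: "'i \<Rightarrow> 'i pt \<Rightarrow> 'i pt"
  emb :: "'i \<Rightarrow> 'i pt \<Rightarrow> 'i pt"

subsection \<open>Stage zero\<close>

definition sin_curve :: "(real \<times> real) set" where
  "sin_curve = {(x, sin (1 / x)) | x. - 2 / pi \<le> x \<and> x < 0} \<union> {0} \<times> {-1..1}"

text \<open>The sequence of \<open>x\<close>-coordinates of the points chosen in stage zero.\<close>

definition admissible :: "(nat \<Rightarrow> real) \<Rightarrow> bool" where
  "admissible u \<longleftrightarrow> (\<forall>n\<ge>1. - 2 / pi < u n \<and> u n < 0) \<and> strict_mono_on {1..} u \<and> u \<longlonglongrightarrow> 0"

definition zero_stage :: "(nat \<Rightarrow> real) \<Rightarrow> 'i stage" where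
  "zero_stage u =
     \<lparr> spc = quot_topology (top_of_set sin_curve) Base,
       pta = Base (- 2 / pi, -1),
       ptq = (\<lambda>n. Base (u n, sin (1 / u n))),
       ret = (\<lambda>_. id),
       emb = (\<lambda>_. id) \<rparr>"

subsection \<open>Successor stages\<close>

definition succ_set :: "'i stage \<Rightarrow> ('i pt \<times> real) set" where
  "succ_set B =
     (\<Union>n\<in>{1..}. cinterval (spc B) (pta B) (ptq B n) \<times> {1 / (2 * real n - 1), 1 / (2 * real n)})
     \<union> topspace (spc B) \<times> {0}"

definition succ_space :: "'i stage \<Rightarrow> ('i pt \<times> real) topology" where
  "succ_space B = subtopology (prod_topology (spc B) (top_of_set {0..1})) (succ_set B)"

definition glue :: "'i stage \<Rightarrow> (('i pt \<times> real) \<times> ('i pt \<times> real)) set" where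
  "glue B =
     {((ptq B n, 1 / (2 * real n - 1)), (ptq B n, 1 / (2 * real n))) | n. n \<ge> 1}
     \<union> {((pta B, 1 / (2 * real n)), (pta B, 1 / (2 * real n + 1))) | n. n \<ge> 1}"

definition cls :: "'i stage \<Rightarrow> 'i pt \<times> real \<Rightarrow> 'i pt" where
  "cls B z = Cls (Abs_fset ((glue B \<union> (glue B)\<inverse>)\<^sup>* `` {z}))"

text \<open>All members of a class have the same first component, which is its projection.\<close>

primrec cls_proj :: "'i pt \<Rightarrow> 'i pt" where
  "cls_proj (Cls S) = (THE x. \<forall>z. z |\<in>| S \<longrightarrow> fst z = x)"

text \<open>Here \<open>\<alpha>\<close> is the successor of \<open>\<beta>\<close> and \<open>B\<close> is stage \<open>\<beta>\<close>.\<close>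

definition succ_stage :: "'i::wellorder \<Rightarrow> 'i stage \<Rightarrow> 'i stage" where
  "succ_stage \<alpha> B =
     \<lparr> spc = quot_topology (succ_space B) (cls B),
       pta = cls B (pta B, 1),
       ptq = (\<lambda>n. cls B (ptq B n, 1 / (2 * real n - 1))),
       ret = (\<lambda>\<gamma>. if \<gamma> < \<alpha> then ret B \<gamma> \<circ> cls_proj else id),
       emb = (\<lambda>\<gamma>. if \<gamma> < \<alpha> then (\<lambda>x. cls B (emb B \<gamma> x, 0)) else id) \<rparr>"

subsection \<open>Limit stages\<close>

definition inv_limit :: "'i::wellorder \<Rightarrow> ('i \<Rightarrow> 'i stage) \<Rightarrow> ('i \<Rightarrow> 'i pt) set" where
  "inv_limit \<alpha> S =
     {x \<in> (\<Pi>\<^sub>E \<beta>\<in>{..<\<alpha>}. topspace (spc (S \<beta>))).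
        \<forall>\<beta><\<alpha>. \<forall>\<gamma>\<le>\<beta>. ret (S \<beta>) \<gamma> (x \<beta>) = x \<gamma>}"

text \<open>
  The embedding sends \<open>y \<in> X(\<gamma>)\<close> to the unique thread that is equal to \<open>y\<close>, as a point of
  \<open>X(\<beta>)\<close>, at all \<open>\<beta>\<close> with \<open>\<gamma> \<le> \<beta> < \<alpha>\<close>; below \<open>\<gamma>\<close> the retractions determine the thread.
\<close>

definition limit_stage :: "'i::wellorder \<Rightarrow> ('i \<Rightarrow> 'i stage) \<Rightarrow> 'i stage" where
  "limit_stage \<alpha> S =
     \<lparr> spc = quot_topology
         (subtopology (product_topology (\<lambda>\<beta>. spc (S \<beta>)) {..<\<alpha>}) (inv_limit \<alpha> S)) Thread,
       pta = Thread (\<lambda>\<beta>\<in>{..<\<alpha>}. pta (S \<beta>)),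
       ptq = (\<lambda>n. Thread (\<lambda>\<beta>\<in>{..<\<alpha>}. ptq (S \<beta>) n)),
       ret = (\<lambda>\<beta>. if \<beta> < \<alpha> then (\<lambda>x. un_Thread x \<beta>) else id),
       emb = (\<lambda>\<gamma>. if \<gamma> < \<alpha>
         then (\<lambda>y. Thread (\<lambda>\<beta>\<in>{..<\<alpha>}. if \<gamma> \<le> \<beta> then emb (S \<beta>) \<gamma> y else ret (S \<gamma>) \<beta> y))
         else id) \<rparr>"

subsection \<open>The recursion\<close>

definition is_zero :: "'i::wellorder \<Rightarrow> bool" where
  "is_zero \<alpha> \<longleftrightarrow> (\<forall>\<beta>. \<alpha> \<le> \<beta>)"

definition is_succ_of :: "'i::wellorder \<Rightarrow> 'i \<Rightarrow> bool" where
  "is_succ_of \<alpha> \<beta> \<longleftrightarrow> \<beta> < \<alpha> \<and> (\<forall>\<gamma>. \<not> (\<beta> < \<gamma> \<and> \<gamma> < \<alpha>))"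

text \<open>
  Ordinals are elements of a well-ordered type. The guard \<open>\<beta> < \<alpha>\<close> only serves the termination
  proof: both uses of \<open>S\<close> are below \<open>\<alpha>\<close>.
\<close>

function X_stage :: "(nat \<Rightarrow> real) \<Rightarrow> 'i::wellorder \<Rightarrow> 'i stage" where
  "X_stage u \<alpha> =
     (let S = (\<lambda>\<beta>. if \<beta> < \<alpha> then X_stage u \<beta> else undefined) in
      if is_zero \<alpha> then zero_stage u
      else if \<exists>\<beta>. is_succ_of \<alpha> \<beta> then succ_stage \<alpha> (S (THE \<beta>. is_succ_of \<alpha> \<beta>))
      else limit_stage \<alpha> S)"
  by pat_completeness auto
termination
  by (relation "inv_image {(x, y). x < y} snd") (auto intro: wf)

declare X_stage.simps [simp del]

lemma is_succ_of_unique: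
  fixes \<alpha> \<beta> \<gamma> :: "'i::wellorder"
  shows "is_succ_of \<alpha> \<beta> \<Longrightarrow> is_succ_of \<alpha> \<gamma> \<Longrightarrow> \<beta> = \<gamma>"
  unfolding is_succ_of_def by (metis linorder_less_linear)

lemma X_stage_zero: "is_zero \<alpha> \<Longrightarrow> X_stage u \<alpha> = zero_stage u"
  by (simp add: X_stage.simps[of u \<alpha>])

lemma X_stage_succ:
  assumes "is_succ_of \<alpha> \<beta>"
  shows "X_stage u \<alpha> = succ_stage \<alpha> (X_stage u \<beta>)"
proof -
  have "(THE \<beta>. is_succ_of \<alpha> \<beta>) = \<beta>"
    using assms is_succ_of_unique by blast
  moreover have "\<not> is_zero \<alpha>" "\<beta> < \<alpha>"
    using assms by (auto simp: is_zero_def is_succ_of_def not_le)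
  ultimately show ?thesis
    using assms by (auto simp: X_stage.simps[of u \<alpha>])
qed


lemma limit_stage_cong:
  assumes S: "\<And>\<beta>. \<beta> < \<alpha> \<Longrightarrow> S \<beta> = S' \<beta>"
  shows "limit_stage \<alpha> S = limit_stage \<alpha> S'"
proof -
  have 1: "product_topology (\<lambda>\<beta>. spc (S \<beta>)) {..<\<alpha>} = product_topology (\<lambda>\<beta>. spc (S' \<beta>)) {..<\<alpha>}"
  proof -
    have "{i \<in> {..<\<alpha>}. U i \<noteq> topspace (spc (S i))} = {i \<in> {..<\<alpha>}. U i \<noteq> topspace (spc (S' i))}" for U
      using S by auto
    moreover have "(\<forall>i\<in>{..<\<alpha>}. openin (spc (S i)) (U i)) = (\<forall>i\<in>{..<\<alpha>}. openin (spc (S' i)) (U i))" for U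
      using S by auto
    ultimately show ?thesis
      unfolding topology_eq openin_product_topology_alt by presburger
  qed
  have "(\<Pi>\<^sub>E \<beta>\<in>{..<\<alpha>}. topspace (spc (S \<beta>))) = (\<Pi>\<^sub>E \<beta>\<in>{..<\<alpha>}. topspace (spc (S' \<beta>)))"
    by (rule PiE_cong) (simp add: S)
  then have 2: "inv_limit \<alpha> S = inv_limit \<alpha> S'"
    unfolding inv_limit_def using S by auto
  have 3: "restrict (\<lambda>\<beta>. pta (S \<beta>)) {..<\<alpha>} = restrict (\<lambda>\<beta>. pta (S' \<beta>)) {..<\<alpha>}"
    "\<And>n. restrict (\<lambda>\<beta>. ptq (S \<beta>) n) {..<\<alpha>} = restrict (\<lambda>\<beta>. ptq (S' \<beta>) n) {..<\<alpha>}"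
    by (rule restrict_ext; simp add: S)+
  have "restrict (\<lambda>\<beta>. if \<gamma> \<le> \<beta> then emb (S \<beta>) \<gamma> y else ret (S \<gamma>) \<beta> y) {..<\<alpha>} =
      restrict (\<lambda>\<beta>. if \<gamma> \<le> \<beta> then emb (S' \<beta>) \<gamma> y else ret (S' \<gamma>) \<beta> y) {..<\<alpha>}"
    if "\<gamma> < \<alpha>" for \<gamma> y
    by (rule restrict_ext) (simp add: S that)
  then have 4: "emb (limit_stage \<alpha> S) = emb (limit_stage \<alpha> S')"
    by (simp add: limit_stage_def fun_eq_iff)
  show ?thesis
    by (rule stage.equality, insert 4, simp_all add: limit_stage_def 1 2 3)
qed

lemma X_stage_limit:
  assumes "\<not> is_zero \<alpha>" and "\<nexists>\<beta>. is_succ_of \<alpha> \<beta>"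
  shows "X_stage u \<alpha> = limit_stage \<alpha> (X_stage u)"
proof -
  have "X_stage u \<alpha> = limit_stage \<alpha> (\<lambda>\<beta>. if \<beta> < \<alpha> then X_stage u \<beta> else undefined)"
    using assms by (subst X_stage.simps) (simp only: Let_def if_False)
  also have "\<dots> = limit_stage \<alpha> (X_stage u)"
    by (rule limit_stage_cong) simp
  finally show ?thesis .
qed

subsection \<open>The space and its trivial composant\<close>

text \<open>\<open>\<omega>\<^sub>1\<close> is the least ordinal with uncountably many predecessors.\<close>

definition is_omega1 :: "'i::wellorder \<Rightarrow> bool" where
  "is_omega1 \<Omega> \<longleftrightarrow> uncountable {..<\<Omega>} \<and> (\<forall>\<alpha><\<Omega>. countable {..<\<alpha>})"

definition X_space :: "(nat \<Rightarrow> real) \<Rightarrow> 'i::wellorder \<Rightarrow> 'i pt topology" where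
  "X_space u \<Omega> = spc (X_stage u \<Omega>)"

definition trivial_composant :: "(nat \<Rightarrow> real) \<Rightarrow> 'i::wellorder \<Rightarrow> 'i pt set" where
  "trivial_composant u \<Omega> = (\<Union>\<alpha>\<in>{..<\<Omega>}. emb (X_stage u \<Omega>) \<alpha> ` topspace (spc (X_stage u \<alpha>)))"

end

theory Submission
  imports Defs
begin

text \<open>
  A countable subset of \<open>E\<close> lies in a single stage: each of its points comes from some \<open>X(\<gamma>)\<close> with
  \<open>\<gamma> < \<omega>\<^sub>1\<close>, and countably many ordinals below \<open>\<omega>\<^sub>1\<close> have a common bound \<open>\<alpha> < \<omega>\<^sub>1\<close>
  (\<open>omega1_countable_bounded\<close>). No such set is dense, because the next stage opens up new room:
  the copy of \<open>X(\<alpha>)\<close> in \<open>X(\<alpha>+1)\<close> is the part at height \<open>0\<close>, and the part at positive height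
  is open (\<open>openin_added_points\<close>). The preimage of that part under the
  retraction of \<open>X\<close> onto \<open>X(\<alpha>+1)\<close> is an open set that misses all \<open>X(\<gamma>)\<close> with \<open>\<gamma> \<le> \<alpha>\<close> but
  contains the point \<open>a\<close> of \<open>X(\<alpha>+1)\<close>, which belongs to \<open>E\<close>.

  Two things about the recursion have to be known for this. The retractions and embeddings must be
  compatible, so that the embedded \<open>a\<close> really is a point of the inverse limit; and the
  gluing classes must be finite, since otherwise the finite sets that represent them carry no
  information and points at positive height might be confused with points at height \<open>0\<close>. A class is
  finite because \<open>a\<close> is different from all \<open>q\<^sup>n\<close>: for a single point \<open>x\<close> the
  gluing then uses only one of its two kinds of identification, and each kind matches heights in
  pairs. Both facts are proved by one transfinite induction (\<open>coherent\<close>).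
\<close>

section \<open>The gluing classes\<close>

lemma glue_fst: "(y, z) \<in> (glue B \<union> (glue B)\<inverse>)\<^sup>* \<Longrightarrow> fst y = fst z"
  by (induction rule: rtrancl_induct) (auto simp: glue_def)

lemma glue_height: "(y, z) \<in> (glue B \<union> (glue B)\<inverse>)\<^sup>* \<Longrightarrow> snd y = 0 \<longleftrightarrow> snd z = 0"
proof (induction rule: rtrancl_induct)
  case (step z w)
  have "snd v \<noteq> 0" "snd v' \<noteq> 0" if "(v, v') \<in> glue B" for v v'
    using that by (auto simp: glue_def)
  with step show ?case by blast
qed simp

text \<open>
  With the heights written as reciprocals of consecutive natural numbers, the two kinds of
  identification have the same form: apart from the base point, only the parity of the smaller
  number tells them apart.
\<close>

lemma glue_edge_cases:
  assumes "(y, z) \<in> glue B \<union> (glue B)\<inverse>"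
  obtains n where "n \<ge> 1" "fst y = ptq B n" "fst z = ptq B n"
      "{snd y, snd z} = {1 / real (2 * n - 1), 1 / real (2 * n)}"
    | n where "n \<ge> 1" "fst y = pta B" "fst z = pta B"
      "{snd y, snd z} = {1 / real (2 * n), 1 / real (2 * n + 1)}"
proof -
  consider n where "n \<ge> 1" "{y, z} = {(ptq B n, 1 / (2 * real n - 1)), (ptq B n, 1 / (2 * real n))}"
    | n where "n \<ge> 1" "{y, z} = {(pta B, 1 / (2 * real n)), (pta B, 1 / (2 * real n + 1))}"
    using assms unfolding glue_def by blast
  then show thesis
  proof cases
    case (1 n)
    then have "real (2 * n - 1) = 2 * real n - 1" by (simp add: of_nat_diff)
    with 1 show ?thesis
      by (intro that(1)[of n]) (auto simp: doubleton_eq_iff)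
  next
    case (2 n)
    then show ?thesis
      by (intro that(2)[of n]) (auto simp: doubleton_eq_iff add.commute)
  qed
qed

text \<open>
  If \<open>a\<close> were equal to some \<open>q\<^sup>n\<close>, the two kinds of identification could alternate and
  link infinitely many heights. Otherwise all links above one point are of the same kind, where
  every height has at most one partner, so two steps lead back.
\<close>

lemma glue_involutive:
  assumes a: "\<And>n. n \<ge> 1 \<Longrightarrow> pta B \<noteq> ptq B n"
    and yz: "(y, z) \<in> glue B \<union> (glue B)\<inverse>" and zw: "(z, w) \<in> glue B \<union> (glue B)\<inverse>"
  shows "y = w"
proof -
  have inj: "1 / real m = 1 / real n \<longleftrightarrow> m = n" for m n
    by (simp add: inverse_eq_divide[symmetric])
  \<comment> \<open>Pairs of consecutive numbers that start at the same parity are equal or disjoint.\<close>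
  have partner: "r = t" if "{r, s} = {1 / real m, 1 / real (Suc m)}" "{s, t} = {1 / real n, 1 / real (Suc n)}"
    "even m = even n" for r s t m n
  proof -
    have "m \<noteq> Suc n" "n \<noteq> Suc m" using that(3) by auto
    then have "m = n" using that(1,2) unfolding doubleton_eq_iff by (metis inj Suc_inject)
    then show ?thesis using that(1,2) unfolding doubleton_eq_iff by metis
  qed
  have q: "Suc (2 * n - 1) = 2 * n" if "n \<ge> 1" for n :: nat using that by simp
  from yz show ?thesis
  proof (cases rule: glue_edge_cases)
    case yz: (1 m)
    from zw show ?thesis
    proof (cases rule: glue_edge_cases)
      case (1 n)
      then have "snd y = snd w"
        using partner[of "snd y" "snd z" "2 * m - 1" "snd w" "2 * n - 1"] yz by (simp add: q)
      then show ?thesis using 1 yz by (simp add: prod_eq_iff)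
    next
      case (2 n)
      then show ?thesis using a yz by metis
    qed
  next
    case yz: (2 m)
    from zw show ?thesis
    proof (cases rule: glue_edge_cases)
      case (1 n)
      then show ?thesis using a yz by metis
    next
      case (2 n)
      then have "snd y = snd w"
        using partner[of "snd y" "snd z" "2 * m" "snd w" "2 * n"] yz by simp
      then show ?thesis using 2 yz by (simp add: prod_eq_iff)
    qed
  qed
qed

lemma finite_glue_class:
  assumes a: "\<And>n. n \<ge> 1 \<Longrightarrow> pta B \<noteq> ptq B n"
  shows "finite ((glue B \<union> (glue B)\<inverse>)\<^sup>* `` {z})"
proof -
  let ?R = "glue B \<union> (glue B)\<inverse>"
  have step: "w = z \<or> (z, w) \<in> ?R" if "(z, w) \<in> ?R\<^sup>*" for w
    using that
  proof (induction rule: rtrancl_induct)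
    case (step v w)
    then show ?case using glue_involutive[OF a] by metis
  qed simp
  have single: "v = w" if "(z, v) \<in> ?R" "(z, w) \<in> ?R" for v w
  proof -
    have "(v, z) \<in> ?R" using that(1) by blast
    then show ?thesis using glue_involutive[OF a] that(2) by metis
  qed
  have "finite (?R `` {z})"
  proof (cases "?R `` {z} = {}")
    case False
    then obtain v where v: "(z, v) \<in> ?R" by blast
    then have "?R `` {z} \<subseteq> {v}" using single by blast
    then show ?thesis using finite_subset by blast
  qed (simp only: finite.emptyI)
  moreover have "?R\<^sup>* `` {z} \<subseteq> insert z (?R `` {z})" using step by blast
  ultimately show ?thesis using finite_subset by blast
qed

lemma cls_eqD:
  assumes a: "\<And>n. n \<ge> 1 \<Longrightarrow> pta B \<noteq> ptq B n" and eq: "cls B y = cls B z"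
  shows "(y, z) \<in> (glue B \<union> (glue B)\<inverse>)\<^sup>*"
proof -
  have "(glue B \<union> (glue B)\<inverse>)\<^sup>* `` {y} = (glue B \<union> (glue B)\<inverse>)\<^sup>* `` {z}"
    using eq finite_glue_class[OF a] by (simp add: cls_def Abs_fset_inject)
  then show ?thesis by blast
qed

lemma cls_proj_cls:
  assumes a: "\<And>n. n \<ge> 1 \<Longrightarrow> pta B \<noteq> ptq B n"
  shows "cls_proj (cls B z) = fst z"
proof -
  let ?C = "(glue B \<union> (glue B)\<inverse>)\<^sup>* `` {z}"
  have mem: "w |\<in>| Abs_fset ?C \<longleftrightarrow> w \<in> ?C" for w
    using finite_glue_class[OF a] by (simp add: Abs_fset_inverse)
  have "(THE x. \<forall>w. w |\<in>| Abs_fset ?C \<longrightarrow> fst w = x) = fst z"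
    unfolding mem
  proof (rule the_equality)
    show "\<forall>w. w \<in> ?C \<longrightarrow> fst w = fst z" using glue_fst by fastforce
  qed blast
  then show ?thesis by (simp add: cls_def)
qed

section \<open>Coherence of the stages\<close>

text \<open>
  The induction hypothesis of the recursion. The conditions belong together: compatibility of the
  maps at a successor needs the projection of a class to be well defined, hence
  \<open>a \<noteq> q\<^sup>n\<close> one stage below; and the membership of \<open>a\<close> in a limit needs the retractions
  to preserve \<open>a\<close>.
\<close>

definition coherent :: "(nat \<Rightarrow> real) \<Rightarrow> 'i::wellorder \<Rightarrow> bool" where
  "coherent u \<alpha> \<longleftrightarrow>
     (let S = X_stage u; X = (\<lambda>\<beta>. topspace (spc (S \<beta>))) in
       pta (S \<alpha>) \<in> X \<alpha> \<and>
       (\<forall>n\<ge>1. pta (S \<alpha>) \<noteq> ptq (S \<alpha>) n) \<and>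
       (\<forall>\<beta>\<le>\<alpha>. ret (S \<alpha>) \<beta> (pta (S \<alpha>)) = pta (S \<beta>)) \<and>
       (\<forall>x. ret (S \<alpha>) \<alpha> x = x) \<and>
       (\<forall>x. emb (S \<alpha>) \<alpha> x = x) \<and>
       (\<forall>\<beta>\<le>\<alpha>. \<forall>x\<in>X \<alpha>. ret (S \<alpha>) \<beta> x \<in> X \<beta>) \<and>
       (\<forall>\<beta>\<le>\<alpha>. \<forall>\<gamma>\<le>\<beta>. \<forall>x\<in>X \<alpha>. ret (S \<beta>) \<gamma> (ret (S \<alpha>) \<beta> x) = ret (S \<alpha>) \<gamma> x) \<and>
       (\<forall>\<gamma>\<le>\<alpha>. \<forall>y\<in>X \<gamma>. emb (S \<alpha>) \<gamma> y \<in> X \<alpha>) \<and>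
       (\<forall>\<beta>\<le>\<alpha>. \<forall>\<gamma>\<le>\<beta>. \<forall>y\<in>X \<gamma>. ret (S \<alpha>) \<beta> (emb (S \<alpha>) \<gamma> y) = emb (S \<beta>) \<gamma> y) \<and>
       (\<forall>\<gamma>\<le>\<alpha>. \<forall>\<beta>\<le>\<gamma>. \<forall>y\<in>X \<gamma>. ret (S \<alpha>) \<beta> (emb (S \<alpha>) \<gamma> y) = ret (S \<gamma>) \<beta> y))"

lemma coherentD:
  assumes "coherent u \<alpha>"
  shows "pta (X_stage u \<alpha>) \<in> topspace (spc (X_stage u \<alpha>))"
    and "n \<ge> 1 \<Longrightarrow> pta (X_stage u \<alpha>) \<noteq> ptq (X_stage u \<alpha>) n"
    and "\<beta> \<le> \<alpha> \<Longrightarrow> ret (X_stage u \<alpha>) \<beta> (pta (X_stage u \<alpha>)) = pta (X_stage u \<beta>)"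
    and "ret (X_stage u \<alpha>) \<alpha> x = x"
    and "emb (X_stage u \<alpha>) \<alpha> x = x"
    and "\<beta> \<le> \<alpha> \<Longrightarrow> x \<in> topspace (spc (X_stage u \<alpha>)) \<Longrightarrow>
      ret (X_stage u \<alpha>) \<beta> x \<in> topspace (spc (X_stage u \<beta>))"
    and "\<beta> \<le> \<alpha> \<Longrightarrow> \<gamma> \<le> \<beta> \<Longrightarrow> x \<in> topspace (spc (X_stage u \<alpha>)) \<Longrightarrow>
      ret (X_stage u \<beta>) \<gamma> (ret (X_stage u \<alpha>) \<beta> x) = ret (X_stage u \<alpha>) \<gamma> x"
    and "\<gamma> \<le> \<alpha> \<Longrightarrow> y \<in> topspace (spc (X_stage u \<gamma>)) \<Longrightarrow>
      emb (X_stage u \<alpha>) \<gamma> y \<in> topspace (spc (X_stage u \<alpha>))"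
    and "\<beta> \<le> \<alpha> \<Longrightarrow> \<gamma> \<le> \<beta> \<Longrightarrow> y \<in> topspace (spc (X_stage u \<gamma>)) \<Longrightarrow>
      ret (X_stage u \<alpha>) \<beta> (emb (X_stage u \<alpha>) \<gamma> y) = emb (X_stage u \<beta>) \<gamma> y"
    and "\<gamma> \<le> \<alpha> \<Longrightarrow> \<beta> \<le> \<gamma> \<Longrightarrow> y \<in> topspace (spc (X_stage u \<gamma>)) \<Longrightarrow>
      ret (X_stage u \<alpha>) \<beta> (emb (X_stage u \<alpha>) \<gamma> y) = ret (X_stage u \<gamma>) \<beta> y"
  using assms unfolding coherent_def Let_def by (elim conjE; meson)+

lemma coherent_zero:
  fixes \<alpha> :: "'i::wellorder"
  assumes u: "admissible u" and z: "is_zero \<alpha>"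
  shows "coherent u \<alpha>"
proof -
  have eq: "\<beta> = \<alpha>" if "\<beta> \<le> \<alpha>" for \<beta>
    using z that by (auto simp: is_zero_def intro: antisym)
  have "sin (- (pi / 2)) = (-1 :: real)" by simp
  then have "sin (1 / (- 2 / pi)) = -1" by (simp add: field_simps)
  then have "(- 2 / pi, -1) \<in> sin_curve"
    unfolding sin_curve_def by (auto simp: field_simps intro!: exI[of _ "- 2 / pi"])
  moreover have "- 2 / pi \<noteq> u n" if "n \<ge> 1" for n
    using u that by (force simp: admissible_def)
  ultimately show ?thesis
    unfolding coherent_def Let_def
    by (auto simp: X_stage_zero[OF z] zero_stage_def topspace_quot_topology dest!: eq)
qed

lemma pta_cinterval: "a \<in> cinterval T a b"
  by (auto simp: cinterval_def)

lemma topspace_succ_space: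
  "topspace (succ_space B) = (topspace (spc B) \<times> {0..1}) \<inter> succ_set B"
  by (simp add: succ_space_def)

text \<open>
  Distinctness of \<open>a\<close> and \<open>q\<^sup>n\<close> is inherited because the projection to the previous stage
  separates them already.
\<close>

lemma coherent_succ:
  fixes \<alpha> \<beta> :: "'i::wellorder"
  assumes suc: "is_succ_of \<alpha> \<beta>" and coh: "coherent u \<beta>"
  shows "coherent u \<alpha>"
proof -
  define B where "B = X_stage u \<beta>"
  define X where "X \<gamma> = topspace (spc (X_stage u \<gamma>))" for \<gamma> :: 'i
  note c = coherentD[OF coh, folded X_def B_def]
  note proj = cls_proj_cls[OF c(2)]
  have XB: "topspace (spc B) = X \<beta>" by (simp add: X_def B_def)
  have S: "X_stage u \<alpha> = succ_stage \<alpha> B"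
    by (simp add: X_stage_succ[OF suc] B_def)
  have X: "X \<alpha> = cls B ` topspace (succ_space B)"
    by (simp add: X_def S succ_stage_def topspace_quot_topology)
  have fst_X: "fst z \<in> X \<beta>" if "z \<in> topspace (succ_space B)" for z
    using that by (auto simp: topspace_succ_space XB)
  have less: "\<gamma> < \<alpha> \<longleftrightarrow> \<gamma> \<le> \<beta>" for \<gamma>
    using suc by (metis is_succ_of_def leD leI le_less_trans)
  have le: "\<gamma> \<le> \<alpha> \<longleftrightarrow> \<gamma> \<le> \<beta> \<or> \<gamma> = \<alpha>" for \<gamma>
    using less by (metis le_less)
  have ba: "\<not> \<alpha> \<le> \<beta>" using less by blast
  have nz: "\<gamma> \<noteq> \<alpha>" if "\<gamma> \<le> \<beta>" for \<gamma> using that ba by auto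
  have ret: "ret (X_stage u \<alpha>) \<gamma> x = (if \<gamma> \<le> \<beta> then ret B \<gamma> (cls_proj x) else x)" for \<gamma> x
    by (simp add: S succ_stage_def less)
  have emb: "emb (X_stage u \<alpha>) \<gamma> y = (if \<gamma> \<le> \<beta> then cls B (emb B \<gamma> y, 0) else y)" for \<gamma> y
    by (simp add: S succ_stage_def less)
  have pta: "pta (X_stage u \<alpha>) = cls B (pta B, 1)"
    by (simp add: S succ_stage_def)
  have ptq: "ptq (X_stage u \<alpha>) n = cls B (ptq B n, 1 / (2 * real n - 1))" for n
    by (simp add: S succ_stage_def)
  have ground: "(x, 0) \<in> topspace (succ_space B)" if "x \<in> X \<beta>" for x
    using that by (simp add: topspace_succ_space XB succ_set_def)
  have "(pta B, 1) \<in> topspace (succ_space B)"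
    using c(1) by (auto simp: topspace_succ_space XB succ_set_def pta_cinterval intro!: bexI[of _ 1])
  then have "pta (X_stage u \<alpha>) \<in> X \<alpha>"
    by (simp add: X pta)
  moreover have "pta (X_stage u \<alpha>) \<noteq> ptq (X_stage u \<alpha>) n" if "n \<ge> 1" for n
    using c(2)[OF that] proj by (metis fst_conv pta ptq)
  moreover have "ret (X_stage u \<alpha>) \<gamma> (pta (X_stage u \<alpha>)) = pta (X_stage u \<gamma>)" if "\<gamma> \<le> \<alpha>" for \<gamma>
    using that c(3) ba by (auto simp: ret pta proj le)
  moreover have "ret (X_stage u \<alpha>) \<gamma> x \<in> X \<gamma>" if "\<gamma> \<le> \<alpha>" "x \<in> X \<alpha>" for \<gamma> x
    using that c(6) fst_X ba by (auto simp: ret X proj le)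
  moreover have "ret (X_stage u \<gamma>) \<delta> (ret (X_stage u \<alpha>) \<gamma> x) = ret (X_stage u \<alpha>) \<delta> x"
    if "\<gamma> \<le> \<alpha>" "\<delta> \<le> \<gamma>" "x \<in> X \<alpha>" for \<gamma> \<delta> x
  proof (cases "\<gamma> = \<alpha>")
    case False
    then show ?thesis
      using that c(7) fst_X order_trans[of \<delta> \<gamma> \<beta>] by (auto simp: ret X proj le)
  qed (use ba in \<open>simp add: ret\<close>)
  moreover have "emb (X_stage u \<alpha>) \<gamma> y \<in> X \<alpha>" if "\<gamma> \<le> \<alpha>" "y \<in> X \<gamma>" for \<gamma> y
    using that c(8) ground ba by (auto simp: emb le X)
  moreover have "ret (X_stage u \<alpha>) \<delta> (emb (X_stage u \<alpha>) \<gamma> y) = emb (X_stage u \<delta>) \<gamma> y"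
    if "\<delta> \<le> \<alpha>" "\<gamma> \<le> \<delta>" "y \<in> X \<gamma>" for \<gamma> \<delta> y
  proof (cases "\<delta> = \<alpha>")
    case False
    then show ?thesis
      using that c(9) order_trans[of \<gamma> \<delta> \<beta>] by (auto simp: ret emb proj le)
  qed (use ba in \<open>simp add: ret\<close>)
  moreover have "ret (X_stage u \<alpha>) \<delta> (emb (X_stage u \<alpha>) \<gamma> y) = ret (X_stage u \<gamma>) \<delta> y"
    if "\<gamma> \<le> \<alpha>" "\<delta> \<le> \<gamma>" "y \<in> X \<gamma>" for \<gamma> \<delta> y
  proof (cases "\<gamma> = \<alpha>")
    case False
    then show ?thesis
      using that c(10) order_trans[of \<delta> \<gamma> \<beta>] by (auto simp: ret emb proj le)
  qed (use ba in \<open>simp add: emb\<close>)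
  ultimately show ?thesis
    unfolding coherent_def Let_def X_def[symmetric] using ba by (auto simp: ret emb)
qed

text \<open>
  Here the retractions are coordinate projections, so the content is that the embeddings
  produce threads; and the threads \<open>a\<close> and \<open>q\<^sup>n\<close> differ because they differ in every coordinate.
\<close>

lemma coherent_limit:
  fixes \<alpha> :: "'i::wellorder"
  assumes lim: "\<not> is_zero \<alpha>" "\<nexists>\<beta>. is_succ_of \<alpha> \<beta>" and coh: "\<And>\<beta>. \<beta> < \<alpha> \<Longrightarrow> coherent u \<beta>"
  shows "coherent u \<alpha>"
proof -
  define X where "X \<gamma> = topspace (spc (X_stage u \<gamma>))" for \<gamma> :: 'i
  note c = coherentD[OF coh, folded X_def]
  have S: "X_stage u \<alpha> = limit_stage \<alpha> (X_stage u)"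
    using lim by (rule X_stage_limit)
  have "inv_limit \<alpha> (X_stage u) \<subseteq> (\<Pi>\<^sub>E \<beta>\<in>{..<\<alpha>}. topspace (spc (X_stage u \<beta>)))"
    by (auto simp: inv_limit_def)
  then have X: "X \<alpha> = Thread ` inv_limit \<alpha> (X_stage u)"
    by (auto simp: X_def S limit_stage_def topspace_quot_topology)
  have ret: "ret (X_stage u \<alpha>) \<gamma> x = (if \<gamma> < \<alpha> then un_Thread x \<gamma> else x)" for \<gamma> x
    by (simp add: S limit_stage_def)
  define T where "T \<gamma> y = (\<lambda>\<beta>\<in>{..<\<alpha>}. if \<gamma> \<le> \<beta> then emb (X_stage u \<beta>) \<gamma> y else ret (X_stage u \<gamma>) \<beta> y)"
    for \<gamma> y
  have emb: "emb (X_stage u \<alpha>) \<gamma> y = (if \<gamma> < \<alpha> then Thread (T \<gamma> y) else y)" for \<gamma> y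
    by (simp add: S limit_stage_def T_def)
  have pta: "pta (X_stage u \<alpha>) = Thread (\<lambda>\<beta>\<in>{..<\<alpha>}. pta (X_stage u \<beta>))"
    by (simp add: S limit_stage_def)
  have ptq: "ptq (X_stage u \<alpha>) n = Thread (\<lambda>\<beta>\<in>{..<\<alpha>}. ptq (X_stage u \<beta>) n)" for n
    by (simp add: S limit_stage_def)
  have T: "T \<gamma> y \<in> inv_limit \<alpha> (X_stage u)" if "\<gamma> < \<alpha>" "y \<in> X \<gamma>" for \<gamma> y
  proof -
    have "T \<gamma> y \<in> (\<Pi>\<^sub>E \<beta>\<in>{..<\<alpha>}. X \<beta>)"
      using that c(6,8) by (auto simp: T_def)
    moreover have "ret (X_stage u \<beta>) \<delta> (T \<gamma> y \<beta>) = T \<gamma> y \<delta>" if "\<beta> < \<alpha>" "\<delta> \<le> \<beta>" for \<beta> \<delta>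
    proof -
      have "\<delta> < \<alpha>" using that by simp
      \<comment> \<open>The thread changes from retractions to embeddings at \<open>\<gamma>\<close>, which may lie below, between or
        above the two coordinates.\<close>
      consider "\<gamma> \<le> \<delta>" | "\<delta> < \<gamma>" "\<gamma> \<le> \<beta>" | "\<beta> < \<gamma>" by force
      then show ?thesis
      proof cases
        case 1
        then show ?thesis
          using c(9) that order_trans[OF 1 that(2)] \<open>\<delta> < \<alpha>\<close> \<open>y \<in> X \<gamma>\<close> by (simp add: T_def)
      next
        case 2
        then show ?thesis
          using c(10) that \<open>\<delta> < \<alpha>\<close> \<open>y \<in> X \<gamma>\<close> by (auto simp: T_def)
      next
        case 3
        then show ?thesis
          using c(7) that \<open>\<delta> < \<alpha>\<close> \<open>\<gamma> < \<alpha>\<close> \<open>y \<in> X \<gamma>\<close> by (auto simp: T_def)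
      qed
    qed
    ultimately show ?thesis
      by (simp add: inv_limit_def X_def)
  qed
  have "(\<lambda>\<beta>\<in>{..<\<alpha>}. pta (X_stage u \<beta>)) \<in> inv_limit \<alpha> (X_stage u)"
    using c(1,3) by (auto simp: inv_limit_def X_def)
  then have "pta (X_stage u \<alpha>) \<in> X \<alpha>"
    by (simp add: X pta)
  moreover have "pta (X_stage u \<alpha>) \<noteq> ptq (X_stage u \<alpha>) n" if "n \<ge> 1" for n
  proof -
    obtain \<beta> where "\<beta> < \<alpha>"
      using lim(1) by (auto simp: is_zero_def not_le)
    then show ?thesis
      using c(2)[OF _ that] by (auto simp: pta ptq dest!: fun_cong[of _ _ \<beta>])
  qed
  moreover have "ret (X_stage u \<alpha>) \<gamma> (pta (X_stage u \<alpha>)) = pta (X_stage u \<gamma>)" if "\<gamma> \<le> \<alpha>" for \<gamma>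
    using that by (auto simp: ret pta)
  moreover have "ret (X_stage u \<alpha>) \<gamma> x \<in> X \<gamma>" if "\<gamma> \<le> \<alpha>" "x \<in> X \<alpha>" for \<gamma> x
  proof (cases "\<gamma> = \<alpha>")
    case False
    then show ?thesis
      using that unfolding X by (auto simp: ret inv_limit_def X_def PiE_iff)
  qed (use that in \<open>simp add: ret\<close>)
  moreover have "ret (X_stage u \<gamma>) \<delta> (ret (X_stage u \<alpha>) \<gamma> x) = ret (X_stage u \<alpha>) \<delta> x"
    if "\<gamma> \<le> \<alpha>" "\<delta> \<le> \<gamma>" "x \<in> X \<alpha>" for \<gamma> \<delta> x
    using that by (auto simp: ret X inv_limit_def le_less)
  moreover have "emb (X_stage u \<alpha>) \<gamma> y \<in> X \<alpha>" if "\<gamma> \<le> \<alpha>" "y \<in> X \<gamma>" for \<gamma> y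
    using that T by (auto simp: emb X)
  moreover have "ret (X_stage u \<alpha>) \<delta> (emb (X_stage u \<alpha>) \<gamma> y) = emb (X_stage u \<delta>) \<gamma> y"
    if "\<delta> \<le> \<alpha>" "\<gamma> \<le> \<delta>" "y \<in> X \<gamma>" for \<gamma> \<delta> y
    using that by (cases "\<delta> = \<alpha>") (auto simp: ret emb T_def)
  moreover have "ret (X_stage u \<alpha>) \<delta> (emb (X_stage u \<alpha>) \<gamma> y) = ret (X_stage u \<gamma>) \<delta> y"
    if "\<gamma> \<le> \<alpha>" "\<delta> \<le> \<gamma>" "y \<in> X \<gamma>" for \<gamma> \<delta> y
  proof (cases "\<gamma> = \<alpha>")
    case False
    then have "\<gamma> < \<alpha>" "\<delta> < \<alpha>" using that by auto
    then show ?thesis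
      using that c(4,5) by (auto simp: ret emb T_def)
  qed (simp add: emb)
  ultimately show ?thesis
    unfolding coherent_def Let_def X_def[symmetric] by (auto simp: ret emb)
qed

lemma coherent:
  fixes \<alpha> :: "'i::wellorder"
  assumes "admissible u"
  shows "coherent u \<alpha>"
proof (induction \<alpha> rule: less_induct)
  case (less \<alpha>)
  consider "is_zero \<alpha>" | \<beta> where "is_succ_of \<alpha> \<beta>" | "\<not> is_zero \<alpha>" "\<nexists>\<beta>. is_succ_of \<alpha> \<beta>"
    by blast
  then show ?case
  proof cases
    case 1
    then show ?thesis by (rule coherent_zero[OF assms])
  next
    case 2
    then show ?thesis
      using less by (intro coherent_succ[OF 2]) (simp add: is_succ_of_def)
  next
    case 3
    then show ?thesis using less by (rule coherent_limit)
  qed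
qed

section \<open>The points added at a successor stage\<close>

definition added_points :: "'i stage \<Rightarrow> 'i pt set" where
  "added_points B = cls B ` {z \<in> topspace (succ_space B). snd z \<noteq> 0}"

text \<open>
  Height \<open>0\<close> is never glued to anything, so the copy of \<open>X(\<beta>)\<close> in \<open>X(\<beta>+1)\<close> is disjoint from the
  added points, and the preimage of the latter is exactly the open set where the height is not \<open>0\<close>.
\<close>

lemma cls_mem_added_points:
  assumes a: "\<And>n. n \<ge> 1 \<Longrightarrow> pta B \<noteq> ptq B n"
    and z: "cls B z \<in> added_points B"
  shows "snd z \<noteq> 0"
proof -
  obtain w where w: "cls B z = cls B w" "snd w \<noteq> 0"
    using z unfolding added_points_def by blast
  have "(z, w) \<in> (glue B \<union> (glue B)\<inverse>)\<^sup>*"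
    using a w(1) by (rule cls_eqD)
  then show ?thesis using glue_height w(2) by blast
qed

lemma openin_added_points:
  assumes a: "\<And>n. n \<ge> 1 \<Longrightarrow> pta B \<noteq> ptq B n"
  shows "openin (spc (succ_stage \<alpha> B)) (added_points B)"
proof -
  have "continuous_map (succ_space B) euclideanreal snd"
    unfolding succ_space_def
    by (rule continuous_map_from_subtopology)
      (metis continuous_map_into_fulltopology continuous_map_snd)
  moreover have "openin euclideanreal (- {0})" by (simp add: open_Compl)
  ultimately have "openin (succ_space B) {z \<in> topspace (succ_space B). snd z \<in> - {0}}"
    by (rule openin_continuous_map_preimage)
  moreover have "{z \<in> topspace (succ_space B). cls B z \<in> added_points B} =
      {z \<in> topspace (succ_space B). snd z \<in> - {0}}"
    (is "?L = ?R")
  proof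
    have "snd z \<noteq> 0" if "cls B z \<in> added_points B" for z
      using a that by (rule cls_mem_added_points)
    then show "?L \<subseteq> ?R" by blast
    show "?R \<subseteq> ?L" by (auto simp: added_points_def)
  qed
  moreover have "added_points B \<subseteq> cls B ` topspace (succ_space B)"
    by (auto simp: added_points_def)
  ultimately show ?thesis
    by (simp add: succ_stage_def openin_quot_topology)
qed

section \<open>The first uncountable ordinal\<close>

lemma omega1_limit:
  fixes \<Omega> :: "'i::wellorder"
  assumes "is_omega1 \<Omega>"
  shows "\<not> is_zero \<Omega>" and "\<nexists>\<beta>. is_succ_of \<Omega> \<beta>"
proof -
  have unc: "uncountable {..<\<Omega>}" and cnt: "\<And>\<alpha>. \<alpha> < \<Omega> \<Longrightarrow> countable {..<\<alpha>}"
    using assms by (auto simp: is_omega1_def)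
  show "\<not> is_zero \<Omega>"
  proof
    assume "is_zero \<Omega>"
    then have "{..<\<Omega>} = {}" by (auto simp: is_zero_def not_less[symmetric])
    with unc show False by simp
  qed
  show "\<nexists>\<beta>. is_succ_of \<Omega> \<beta>"
  proof
    assume "\<exists>\<beta>. is_succ_of \<Omega> \<beta>"
    then obtain \<beta> where \<beta>: "is_succ_of \<Omega> \<beta>" ..
    have "x \<in> insert \<beta> {..<\<beta>}" if "x < \<Omega>" for x
      using that \<beta> linorder_less_linear[of x \<beta>] by (auto simp: is_succ_of_def)
    then have "{..<\<Omega>} \<subseteq> insert \<beta> {..<\<beta>}" by blast
    moreover have "countable (insert \<beta> {..<\<beta>})"
      using \<beta> cnt by (simp add: is_succ_of_def)
    ultimately show False using unc countable_subset by blast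
  qed
qed

lemma omega1_countable_bounded:
  fixes \<Omega> :: "'i::wellorder"
  assumes "is_omega1 \<Omega>" and "countable A" and "A \<subseteq> {..<\<Omega>}"
  obtains \<alpha> where "\<alpha> < \<Omega>" and "\<And>\<beta>. \<beta> \<in> A \<Longrightarrow> \<beta> \<le> \<alpha>"
proof -
  have "\<exists>\<alpha><\<Omega>. \<forall>\<beta>\<in>A. \<beta> \<le> \<alpha>"
  proof (rule ccontr)
    assume "\<not> ?thesis"
    then have "{..<\<Omega>} \<subseteq> (\<Union>\<beta>\<in>A. {..<\<beta>})"
      unfolding not_le[symmetric] lessThan_def by blast
    moreover have "countable (\<Union>\<beta>\<in>A. {..<\<beta>})"
      using assms by (auto simp: is_omega1_def)
    ultimately show False
      using assms(1) countable_subset by (auto simp: is_omega1_def)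
  qed
  then show thesis using that by blast
qed

lemma omega1_succ:
  fixes \<Omega> :: "'i::wellorder"
  assumes "is_omega1 \<Omega>" and "\<alpha> < \<Omega>"
  obtains \<sigma> where "is_succ_of \<sigma> \<alpha>" and "\<sigma> < \<Omega>"
proof -
  define \<sigma> where "\<sigma> = (LEAST \<sigma>. \<alpha> < \<sigma>)"
  have "\<alpha> < \<sigma>" and "\<sigma> \<le> \<Omega>" and "\<And>\<gamma>. \<alpha> < \<gamma> \<Longrightarrow> \<sigma> \<le> \<gamma>"
    unfolding \<sigma>_def using assms(2) by (auto intro: LeastI Least_le)
  then have "is_succ_of \<sigma> \<alpha>"
    by (auto simp: is_succ_of_def not_less[symmetric])
  moreover from this have "\<sigma> < \<Omega>"
    using omega1_limit(2)[OF assms(1)] \<open>\<sigma> \<le> \<Omega>\<close> by (auto simp: le_less)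
  ultimately show thesis by (rule that)
qed

section \<open>Non-separability\<close>

theorem claim16:
  fixes u :: "nat \<Rightarrow> real" and \<Omega> :: "'i::wellorder"
  assumes "admissible u" and "is_omega1 \<Omega>"
  shows "\<not> separable_space (subtopology (X_space u \<Omega>) (trivial_composant u \<Omega>))"
proof
  define S :: "'i \<Rightarrow> 'i stage" where "S = X_stage u"
  define E where "E = trivial_composant u \<Omega>"
  define Y where "Y = subtopology (X_space u \<Omega>) E"
  have "coherent u \<alpha>" for \<alpha> :: 'i
    using assms(1) by (rule coherent)
  note coh = coherentD[OF this, folded S_def]
  have lim: "S \<Omega> = limit_stage \<Omega> S"
    unfolding S_def using omega1_limit[OF assms(2)] by (rule X_stage_limit)
  assume "separable_space (subtopology (X_space u \<Omega>) (trivial_composant u \<Omega>))"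
  then obtain D where D: "countable D" "D \<subseteq> topspace Y" "Y closure_of D = topspace Y"
    unfolding separable_space_def Y_def E_def by blast
  have "\<forall>d\<in>D. \<exists>\<gamma><\<Omega>. d \<in> emb (S \<Omega>) \<gamma> ` topspace (spc (S \<gamma>))"
    using D(2) by (force simp: Y_def E_def S_def trivial_composant_def)
  then obtain r where r: "\<And>d. d \<in> D \<Longrightarrow> r d < \<Omega>"
    "\<And>d. d \<in> D \<Longrightarrow> d \<in> emb (S \<Omega>) (r d) ` topspace (spc (S (r d)))"
    by metis
  have "countable (r ` D)" "r ` D \<subseteq> {..<\<Omega>}"
    using D(1) r(1) by auto
  then obtain \<alpha> where "\<alpha> < \<Omega>" and \<alpha>: "\<And>\<beta>. \<beta> \<in> r ` D \<Longrightarrow> \<beta> \<le> \<alpha>"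
    using omega1_countable_bounded[OF assms(2)] by metis
  obtain \<sigma> where \<sigma>: "is_succ_of \<sigma> \<alpha>" "\<sigma> < \<Omega>"
    using omega1_succ[OF assms(2) \<open>\<alpha> < \<Omega>\<close>] .
  have suc: "S \<sigma> = succ_stage \<sigma> (S \<alpha>)" and "\<alpha> < \<sigma>"
    using \<sigma>(1) by (auto simp: S_def X_stage_succ is_succ_of_def)
  \<comment> \<open>An open set that meets \<open>E\<close> but not \<open>D\<close>.\<close>
  define U where "U = {x \<in> topspace (X_space u \<Omega>). ret (S \<Omega>) \<sigma> x \<in> added_points (S \<alpha>)}"

  have "continuous_map (X_space u \<Omega>) (spc (S \<sigma>)) (ret (S \<Omega>) \<sigma>)"
  proof -
    let ?L = "subtopology (product_topology (\<lambda>\<beta>. spc (S \<beta>)) {..<\<Omega>}) (inv_limit \<Omega> S)"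
    have "continuous_map ?L (spc (S \<sigma>)) (\<lambda>x. x \<sigma>)"
      using \<sigma>(2) by (intro continuous_map_from_subtopology continuous_map_product_projection) simp
    moreover have "ret (S \<Omega>) \<sigma> \<circ> Thread = (\<lambda>x. x \<sigma>)"
      using \<sigma>(2) by (auto simp: lim limit_stage_def)
    moreover have "X_space u \<Omega> = quot_topology ?L Thread"
      unfolding X_space_def S_def[symmetric] by (subst lim) (simp add: limit_stage_def)
    ultimately show ?thesis
      using continuous_compose_quotient_map_eq[OF quotient_map_quot_topology] by metis
  qed
  then have "openin (X_space u \<Omega>) U"
    unfolding U_def
  proof (rule openin_continuous_map_preimage)
    show "openin (spc (S \<sigma>)) (added_points (S \<alpha>))"
      unfolding suc using coh(2) by (rule openin_added_points)
  qed
  then have "openin Y (U \<inter> E)"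
    by (auto simp: Y_def openin_subtopology)

  moreover have "d \<notin> U" if "d \<in> D" for d
  proof -
    obtain y where y: "y \<in> topspace (spc (S (r d)))" "d = emb (S \<Omega>) (r d) y"
      using r(2)[OF \<open>d \<in> D\<close>] by blast
    \<comment> \<open>The embedding of a stage \<open>\<gamma> \<le> \<alpha>\<close> passes through \<open>X(\<alpha>)\<close>, hence through height \<open>0\<close> in
      \<open>X(\<alpha>+1)\<close>.\<close>
    have "r d \<le> \<alpha>" using \<alpha> that by blast
    then have "r d < \<sigma>" using \<open>\<alpha> < \<sigma>\<close> by simp
    then have "ret (S \<Omega>) \<sigma> d = cls (S \<alpha>) (emb (S \<alpha>) (r d) y, 0)"
      using coh(9)[of \<sigma> \<Omega> "r d" y] y \<sigma>(2) by (simp add: suc succ_stage_def)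
    moreover have "cls (S \<alpha>) (x, 0) \<notin> added_points (S \<alpha>)" for x
      using cls_mem_added_points[of "S \<alpha>" "(x, 0)"] coh(2) by auto
    ultimately show ?thesis by (simp add: U_def)
  qed

  moreover have "emb (S \<Omega>) \<sigma> (pta (S \<sigma>)) \<in> U \<inter> E"
  proof -
    let ?x = "emb (S \<Omega>) \<sigma> (pta (S \<sigma>))"
    have "?x \<in> topspace (X_space u \<Omega>)"
      using coh(8)[OF _ coh(1)] \<sigma>(2) by (simp add: X_space_def S_def)
    moreover have "ret (S \<Omega>) \<sigma> ?x = pta (S \<sigma>)"
      using coh(9)[OF _ _ coh(1), of \<sigma> \<Omega>] coh(5) \<sigma>(2) by simp
    moreover have "(pta (S \<alpha>), 1) \<in> topspace (succ_space (S \<alpha>))"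
      using coh(1)
      by (auto simp: topspace_succ_space succ_set_def pta_cinterval intro!: bexI[of _ 1])
    then have "pta (S \<sigma>) \<in> added_points (S \<alpha>)"
      by (force simp: suc succ_stage_def added_points_def)
    moreover have "?x \<in> E"
      using \<sigma>(2) coh(1)[of \<sigma>] unfolding E_def trivial_composant_def S_def by blast
    ultimately show ?thesis by (simp add: U_def)
  qed
  ultimately show False
    using D(3) openin_subset[of Y "U \<inter> E"] unfolding closure_of_def by blast
qed

end
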